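(* Let $(\alpha_n,\beta_n)_{n\in\mathbb{Z}}$ be a bilateral Bailey pair relative to $a$, let $N\geq0$ be an integer and $\rho,\sigma$ complex parameters. Define for $n\in\mathbb{Z}$ \[ \alpha'_n=\frac{(\rho,\sigma)_n(aq^{1-N}/\rho\sigma)^n}{(aq^{1-N}/\rho,aq^{1-N}/\sigma)_n}(1-aq^{2n-N})(aq^{1-N})_N\sum_{j=0}^N(-1)^j\frac{q^{N(n-j)+j(j-1)/2}}{(aq^{2n-N-j})_{N+1}}\begin{bmatrix}N\\ j\end{bmatrix}\alpha_{n-j}, \] \[ \beta'_n=\sum_{j\le n}\frac{(\rho,\sigma)_j(aq^{1-N}/\rho\sigma)_{n-j}(aq^{1-N}/\rho\sigma)^j}{(q)_{n-j}(aq^{1-N}/\rho,aq^{1-N}/\sigma)_n}q^{jN}\beta_j . \] Then, subject to convergence conditions on $\alpha_n,\beta_n$ making all the relevant infinite series absolutely convergent, $(\alpha'_n,\beta'_n)$ is a bilateral Bailey pair relative to $aq^{-N}$.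
   Context: Fix complex numbers $a,q$ with $|q|<1$ (parameters generic so that no denominator vanishes). For complex $x$, $(x)_\infty=\prod_{j\ge0}(1-xq^j)$ and for $k\in\mathbb{Z}$, $(x)_k=(x)_\infty/(xq^k)_\infty$ (so $1/(q)_k=0$ for $k<0$); $(x_1,\dots,x_m)_k=(x_1)_k\cdots(x_m)_k$. A bilateral Bailey pair relative to $c$ is a pair of sequences $(\alpha_n)_{n\in\mathbb{Z}},(\beta_n)_{n\in\mathbb{Z}}$ such that for every $n\in\mathbb{Z}$, $\beta_n=\sum_{j\le n}\frac{\alpha_j}{(q)_{n-j}(cq)_{n+j}}$ (the series being convergent). For integers $N\ge0$ and $j$, $\begin{bmatrix}N\\ j\end{bmatrix}=\frac{(q)_N}{(q)_j(q)_{N-j}}$ if $0\le j\le N$ and $0$ otherwise. *)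

theory Defs
  imports "HOL-Analysis.Analysis"
begin

definition qpoch_inf :: "complex \<Rightarrow> complex \<Rightarrow> complex" where
  "qpoch_inf q x = (\<Prod>j. 1 - x * q ^ j)"

(* For k < 0 the denominator of qpoch q q k is 0, so qpoch q q k = 0 and hence
   1 / qpoch q q k = 0 by the convention z / 0 = 0, which is the usual 1/(q)_k = 0. *)
definition qpoch :: "complex \<Rightarrow> complex \<Rightarrow> int \<Rightarrow> complex" where
  "qpoch q x k = qpoch_inf q x / qpoch_inf q (x * q powi k)"

definition qbinom :: "complex \<Rightarrow> nat \<Rightarrow> int \<Rightarrow> complex" where
  "qbinom q N j =
     (if 0 \<le> j \<and> j \<le> int N
      then qpoch q q (int N) / (qpoch q q j * qpoch q q (int N - j)) else 0)"

definition bailey_term :: "complex \<Rightarrow> complex \<Rightarrow> (int \<Rightarrow> complex) \<Rightarrow> int \<Rightarrow> int \<Rightarrow> complex" where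
  "bailey_term q c \<alpha> n j = \<alpha> j / (qpoch q q (n - j) * qpoch q (c * q) (n + j))"

(* A series over all integers j \<le> n is summed in the order j = n, n - 1, n - 2, ... *)
definition bilateral_bailey_pair ::
  "complex \<Rightarrow> complex \<Rightarrow> (int \<Rightarrow> complex) \<Rightarrow> (int \<Rightarrow> complex) \<Rightarrow> bool" where
  "bilateral_bailey_pair q c \<alpha> \<beta> \<longleftrightarrow>
     (\<forall>n. (\<lambda>k. bailey_term q c \<alpha> n (n - int k)) sums \<beta> n)"

definition lattice_alpha ::
  "complex \<Rightarrow> complex \<Rightarrow> nat \<Rightarrow> complex \<Rightarrow> complex \<Rightarrow> (int \<Rightarrow> complex) \<Rightarrow> int \<Rightarrow> complex" where
  "lattice_alpha q a N \<rho> \<sigma> \<alpha> n =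
     qpoch q \<rho> n * qpoch q \<sigma> n * (a * q powi (1 - int N) / (\<rho> * \<sigma>)) powi n
     / (qpoch q (a * q powi (1 - int N) / \<rho>) n * qpoch q (a * q powi (1 - int N) / \<sigma>) n)
     * (1 - a * q powi (2 * n - int N)) * qpoch q (a * q powi (1 - int N)) (int N)
     * (\<Sum>j=0..N. (-1) ^ j
          * (q powi (int N * (n - int j) + int j * (int j - 1) div 2)
             / qpoch q (a * q powi (2 * n - int N - int j)) (int N + 1))
          * qbinom q N (int j) * \<alpha> (n - int j))"

definition lattice_weight ::
  "complex \<Rightarrow> complex \<Rightarrow> nat \<Rightarrow> complex \<Rightarrow> complex \<Rightarrow> int \<Rightarrow> int \<Rightarrow> complex" where
  "lattice_weight q a N \<rho> \<sigma> n j =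
     qpoch q \<rho> j * qpoch q \<sigma> j * qpoch q (a * q powi (1 - int N) / (\<rho> * \<sigma>)) (n - j)
     * (a * q powi (1 - int N) / (\<rho> * \<sigma>)) powi j
     / (qpoch q q (n - j)
        * (qpoch q (a * q powi (1 - int N) / \<rho>) n * qpoch q (a * q powi (1 - int N) / \<sigma>) n))
     * q powi (j * int N)"

definition lattice_beta ::
  "complex \<Rightarrow> complex \<Rightarrow> nat \<Rightarrow> complex \<Rightarrow> complex \<Rightarrow> (int \<Rightarrow> complex) \<Rightarrow> int \<Rightarrow> complex" where
  "lattice_beta q a N \<rho> \<sigma> \<beta> n =
     (\<Sum>k. lattice_weight q a N \<rho> \<sigma> n (n - int k) * \<beta> (n - int k))"

end

theory Submission
  imports Defs
begin

text \<open>
  Put b = a q^{-N}, z = b q / (rho sigma) and u_b(j, r) = 1 / ((q)_{j-r} (bq)_{j+r}). Two finite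
  identities carry the proof. The first is
  q^{jN} u_a(j, r) = sum_{i <= N} C_i(r) u_b(j, r + i), obtained by iterating the elementary case
  N = 1; the coefficients C_i(r) are those of the inner sum of alpha'. The second is the
  q-Pfaff-Saalschuetz sum, which evaluates the sum over j of the weights of beta' (without the
  factor q^{jN}) against u_b(j, m), with value T(n, m), say. Interchanging the two summations in beta'_n and applying both
  identities yields sum_r alpha_r sum_i C_i(r) T(n, r + i), and the substitution m = r + i gives the
  claim.

  The substitution requires that each series sum_r alpha_r C_i(r) T(n, r + i) converges by itself.
  Its coefficients, divided by u_a(n - p, r), have consecutive ratios (from r to r - 1) that tend to
  a constant times q^p as r tends to minus infinity. For large p they are therefore
  dominated by the slice j = n - p of the absolutely convergent double series; that slice carries a
  nonzero weight because (z)_p does not vanish.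
\<close>

section \<open>Bilateral series and ratio tests\<close>

text \<open>The quotient runs downwards because every series here extends to minus infinity. Such
  limits multiply along products, which gives a calculus for hypergeometric terms.\<close>

definition ratio_at_bot :: "(int \<Rightarrow> complex) \<Rightarrow> complex \<Rightarrow> bool" where
  "ratio_at_bot f l \<longleftrightarrow> ((\<lambda>r. f (r - 1) / f r) \<longlongrightarrow> l) at_bot"

lemma ratio_at_bot_mult:
  "ratio_at_bot f l \<Longrightarrow> ratio_at_bot g m \<Longrightarrow> ratio_at_bot (\<lambda>r. f r * g r) (l * m)"
  unfolding ratio_at_bot_def by (drule (1) tendsto_mult) simp

lemma ratio_at_bot_inverse:
  "ratio_at_bot f l \<Longrightarrow> l \<noteq> 0 \<Longrightarrow> ratio_at_bot (\<lambda>r. inverse (f r)) (inverse l)"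
  unfolding ratio_at_bot_def by (drule (1) tendsto_inverse) (simp add: field_simps)

lemma ratio_at_bot_const: "c \<noteq> 0 \<Longrightarrow> ratio_at_bot (\<lambda>r. c) 1"
  by (simp add: ratio_at_bot_def)

lemma ratio_at_bot_powi: "x \<noteq> 0 \<Longrightarrow> ratio_at_bot (\<lambda>r. x powi r) (inverse x)"
  by (simp add: ratio_at_bot_def power_int_diff field_simps)

lemma filterlim_pred_at_bot: "filterlim (\<lambda>r::int. r - c) at_bot at_bot"
  unfolding filterlim_at_bot eventually_at_bot_linorder
  by (metis add.commute diff_le_eq)

lemma filterlim_double_at_bot: "filterlim (\<lambda>r::int. 2 * r - c) at_bot at_bot"
  unfolding filterlim_at_bot eventually_at_bot_linorder
proof
  fix Z
  show "\<exists>N. \<forall>n\<le>N. 2 * n - c \<le> Z"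
    by (rule exI[of _ "min 0 (Z + c)"]) auto
qed

lemma ratio_at_bot_shift: "ratio_at_bot f l \<Longrightarrow> ratio_at_bot (\<lambda>r. f (r + c)) l"
  unfolding ratio_at_bot_def
  using filterlim_compose[OF _ filterlim_pred_at_bot[of "-c"]]
  by (simp add: o_def algebra_simps) blast

text \<open>One step of r is two steps of 2 * r, hence the square. Nonvanishing lets the middle
  value \<open>f (2 * r - 1)\<close> cancel.\<close>

lemma ratio_at_bot_double:
  assumes "ratio_at_bot f l" and nz: "\<And>r. f r \<noteq> 0"
  shows "ratio_at_bot (\<lambda>r. f (2 * r)) (l * l)"
proof -
  have lim: "((\<lambda>r. f (2 * r - c - 1) / f (2 * r - c)) \<longlongrightarrow> l) at_bot" for c
    using filterlim_compose[OF assms(1)[unfolded ratio_at_bot_def] filterlim_double_at_bot[of c]] .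
  have "((\<lambda>r. f (2 * r - 1 - 1) / f (2 * r - 1) * (f (2 * r - 0 - 1) / f (2 * r - 0))) \<longlongrightarrow> l * l) at_bot"
    by (intro tendsto_mult lim)
  then show ?thesis
    using nz by (simp add: ratio_at_bot_def algebra_simps)
qed

text \<open>Eventually the norms do not grow as r decreases, so the norm at \<open>R\<close> is a
  bound. Where \<open>f r = 0\<close> the quotient is 0 by convention and says nothing about
  \<open>f (r - 1)\<close>; \<open>nz\<close> excludes this.\<close>

lemma ratio_at_bot_bounded:
  assumes "ratio_at_bot f l" "norm l < 1" and nz: "eventually (\<lambda>r. f r \<noteq> 0) at_bot"
  obtains R C where "\<And>r. r \<le> R \<Longrightarrow> norm (f r) \<le> C"
proof -
  have "((\<lambda>r. norm (f (r - 1) / f r)) \<longlongrightarrow> norm l) at_bot"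
    using assms(1) unfolding ratio_at_bot_def by (rule tendsto_norm)
  then have "eventually (\<lambda>r. norm (f (r - 1) / f r) < 1) at_bot"
    using assms(2) by (rule order_tendstoD)
  with nz have "eventually (\<lambda>r. norm (f (r - 1)) \<le> norm (f r)) at_bot"
    by eventually_elim (simp add: norm_divide field_simps)
  then obtain R where R: "\<And>r. r \<le> R \<Longrightarrow> norm (f (r - 1)) \<le> norm (f r)"
    by (auto simp: eventually_at_bot_linorder)
  have "norm (f r) \<le> norm (f R)" if "r \<le> R" for r
    using that by (induction rule: int_le_induct) (use R order_trans in blast)+
  then show ?thesis using that by blast
qed

lemma has_sum_finite_sum:
  fixes f :: "'i \<Rightarrow> 'a \<Rightarrow> 'b :: topological_comm_monoid_add"
  assumes "finite I" "\<And>i. i \<in> I \<Longrightarrow> (f i has_sum s i) A"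
  shows "((\<lambda>x. \<Sum>i\<in>I. f i x) has_sum (\<Sum>i\<in>I. s i)) A"
  using assms by (induction I) (auto intro!: has_sum_add)

text \<open>Leads from unordered sums, which permit rearrangement, back to the ordered series used
  in the definition of Bailey pairs.\<close>

lemma sums_of_has_sum_atMost_int:
  fixes g :: "int \<Rightarrow> 'a :: {comm_monoid_add, topological_space}"
  assumes "(g has_sum S) {..n}"
  shows "(\<lambda>k. g (n - int k)) sums S"
proof -
  have "((\<lambda>k. g (n - int k)) has_sum S) UNIV \<longleftrightarrow> (g has_sum S) {..n}"
    by (rule has_sum_reindex_bij_witness[of _ "\<lambda>m. nat (n - m)" "\<lambda>k. n - int k"]) auto
  with assms show ?thesis by (simp add: has_sum_imp_sums)
qed

section \<open>q-Pochhammer symbols\<close>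

text \<open>Invariant under multiplying x by powers of q, this keeps numerator and denominator of
  (x)_k nonzero for all integers k at once.\<close>

definition qgeneric :: "complex \<Rightarrow> complex \<Rightarrow> bool" where
  "qgeneric q x \<longleftrightarrow> (\<forall>k::int. x * q powi k \<noteq> 1)"

text \<open>A total form of 1/(q)_k with value 0 for negative k, so that kernels and q-binomials
  need no range conditions.\<close>

definition qrecip :: "complex \<Rightarrow> int \<Rightarrow> complex" where
  "qrecip q k = 1 / qpoch q q k"

lemma qgeneric_shift: "q \<noteq> 0 \<Longrightarrow> qgeneric q x \<Longrightarrow> qgeneric q (x * q powi k)"
  by (simp add: qgeneric_def mult.assoc flip: power_int_add)

lemma qpoch_0: "qpoch_inf q x \<noteq> 0 \<Longrightarrow> qpoch q x 0 = 1"
  by (simp add: qpoch_def)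

text \<open>The u_b(j, r) of the overview: the coefficient of alpha_r in beta_j for a pair relative
  to b.\<close>

definition qkernel :: "complex \<Rightarrow> complex \<Rightarrow> int \<Rightarrow> int \<Rightarrow> complex" where
  "qkernel q b j r = qrecip q (j - r) / qpoch q (b * q) (j + r)"

text \<open>The C_i(r) of the overview. At r = m - i and b = a q^{-N} it is the coefficient of
  alpha_{m-i} in alpha'_m, apart from the prefactor in rho and sigma.\<close>

definition shift_coeff :: "complex \<Rightarrow> complex \<Rightarrow> nat \<Rightarrow> int \<Rightarrow> nat \<Rightarrow> complex" where
  "shift_coeff q b N r i =
     (1 - b * q powi (2 * r + 2 * int i)) * qpoch q (b * q) (int N) * (-1) ^ i
     * q powi (int N * r + int i * (int i - 1) div 2)
     / qpoch q (b * q powi (2 * r + int i)) (int N + 1) * qbinom q N (int i)"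

lemma powi_double: "x powi (2 * k) = x powi k * x powi k" for x :: complex
  by (metis power2_eq_square power_int_mult power_int_numeral mult.commute)

context
  fixes q :: complex
  assumes q0: "q \<noteq> 0" and q1: "norm q < 1"
begin

section \<open>Infinite products and the recurrences of (x)_k\<close>

lemma qpoch_inf_converges: "convergent_prod (\<lambda>j. 1 - x * q ^ j)"
proof -
  have "summable (\<lambda>j. norm (1 - x * q ^ j - 1))"
    using q1 by (simp add: norm_mult norm_power summable_mult summable_geometric)
  then show ?thesis
    by (intro abs_convergent_prod_imp_convergent_prod summable_imp_abs_convergent_prod)
qed

lemma qpoch_inf_eq_0_iff: "qpoch_inf q x = 0 \<longleftrightarrow> (\<exists>j. x * q ^ j = 1)"
  using has_prod_eq_0_iff[OF convergent_prod_has_prod[OF qpoch_inf_converges[of x]]]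
  by (auto simp: qpoch_inf_def eq_commute[of 1])

lemma qpoch_inf_rec: "qpoch_inf q x = (1 - x) * qpoch_inf q (x * q)"
\<comment> \<open>A factor can be split off a convergent product only if it is nonzero; at x = 1
  both sides are 0.\<close>
proof (cases "x = 1")
  case True
  then show ?thesis using qpoch_inf_eq_0_iff[of x] by (auto intro: exI[of _ 0])
next
  case False
  have "(\<lambda>j. 1 - x * q ^ j) has_prod (qpoch_inf q (x * q) * (1 - x * q ^ 0))"
    using convergent_prod_has_prod[OF qpoch_inf_converges[of "x * q"]] False
    using has_prod_Suc_iff[of "\<lambda>j. 1 - x * q ^ j"] by (simp add: mult.assoc qpoch_inf_def)
  then show ?thesis
    using has_prod_unique by (fastforce simp: qpoch_inf_def mult_ac)
qed

lemma qpoch_inf_generic: "qgeneric q x \<Longrightarrow> qpoch_inf q x \<noteq> 0"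
  by (metis qgeneric_def qpoch_inf_eq_0_iff power_int_of_nat)

lemma qpoch_nonzero: "qgeneric q x \<Longrightarrow> qpoch q x k \<noteq> 0"
  using qgeneric_shift[OF q0] by (simp add: qpoch_def qpoch_inf_generic)

lemma qpoch_add:
  assumes "qpoch_inf q (x * q powi m) \<noteq> 0"
  shows "qpoch q x (m + k) = qpoch q x m * qpoch q (x * q powi m) k"
  using assms by (simp add: qpoch_def power_int_add q0 mult.assoc)

lemma qpoch_1:
  assumes "qpoch_inf q x \<noteq> 0"
  shows "qpoch q x 1 = 1 - x"
  using assms qpoch_inf_rec[of x] by (simp add: qpoch_def)

lemma qpoch_rec:
  assumes "qpoch_inf q (x * q powi k) \<noteq> 0"
  shows "qpoch q x (k + 1) = qpoch q x k * (1 - x * q powi k)"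
  using qpoch_add[OF assms] qpoch_1[OF assms] by simp

lemma qpoch_generic_rec:
  "qgeneric q x \<Longrightarrow> qpoch q x (k + 1) = qpoch q x k * (1 - x * q powi k)"
  using qgeneric_shift[OF q0] by (intro qpoch_rec qpoch_inf_generic)

lemma qpoch_generic_add:
  "qgeneric q x \<Longrightarrow> qpoch q x (m + k) = qpoch q x m * qpoch q (x * q powi m) k"
  using qgeneric_shift[OF q0] by (intro qpoch_add qpoch_inf_generic)

text \<open>For natural indices the nonvanishing of (x)_inf suffices. This covers x = q, which is
  not generic.\<close>

lemma qpoch_Suc:
  assumes "qpoch_inf q x \<noteq> 0"
  shows "qpoch q x (int (Suc k)) = qpoch q x (int k) * (1 - x * q ^ k)"
proof -
  have "qpoch_inf q (x * q powi int k) \<noteq> 0"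
    using assms unfolding qpoch_inf_eq_0_iff
    by (metis mult.assoc power_add power_int_of_nat)
  from qpoch_rec[OF this] show ?thesis by (simp add: add.commute)
qed

section \<open>The symbols (q)_k and the q-binomial coefficients\<close>

lemma q_power_Suc_neq_1: "q ^ Suc k \<noteq> 1"
  using q1 by (metis norm_one norm_power power_Suc_less_one less_irrefl
      zero_less_norm_iff q0)

lemma qpoch_inf_q_nonzero: "qpoch_inf q q \<noteq> 0"
  using q_power_Suc_neq_1 by (auto simp: qpoch_inf_eq_0_iff)

text \<open>For k < 0 the denominator (q^{k+1})_inf contains the factor 1 - q^0, and division by
  zero yields 0; otherwise numerator and denominator are both nonzero.\<close>

lemma qpoch_q_eq_0_iff: "qpoch q q k = 0 \<longleftrightarrow> k < 0"
proof -
  have "(\<exists>j. q * q powi k * q ^ j = 1) \<longleftrightarrow> k < 0"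
  proof
    assume "\<exists>j. q * q powi k * q ^ j = 1"
    then obtain j where j: "q powi (1 + k + int j) = 1"
      by (auto simp: power_int_add q0)
    show "k < 0"
    proof (rule ccontr)
      assume "\<not> k < 0"
      then have "1 + k + int j = int (Suc (nat k + j))" by simp
      with j q_power_Suc_neq_1 show False by (metis power_int_of_nat)
    qed
  next
    assume "k < 0"
    then have "q * q powi k * q ^ nat (- 1 - k) = q powi (1 + k + (- 1 - k))"
      using q0 by (simp add: power_int_minus power_int_diff field_simps flip: power_int_of_nat)
    then show "\<exists>j. q * q powi k * q ^ j = 1" by auto
  qed
  then show ?thesis
    using qpoch_inf_q_nonzero qpoch_inf_eq_0_iff by (simp add: qpoch_def)
qed

lemma qrecip_neg: "k < 0 \<Longrightarrow> qrecip q k = 0"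
  using qpoch_q_eq_0_iff by (simp add: qrecip_def)

lemma qrecip_0 [simp]: "qrecip q 0 = 1"
  using qpoch_0[OF qpoch_inf_q_nonzero] by (simp add: qrecip_def)

lemma qrecip_nonzero: "k \<ge> 0 \<Longrightarrow> qrecip q k \<noteq> 0"
  using qpoch_q_eq_0_iff by (simp add: qrecip_def)

text \<open>Valid for every integer k: at k = -1 the factor 1 - q^0 makes the right side vanish, and
  below that both reciprocals are 0.\<close>

lemma qrecip_rec: "qrecip q k = qrecip q (k + 1) * (1 - q powi (k + 1))"
proof (cases "k < 0")
  case True
  then show ?thesis by (cases "k = -1") (auto simp: qrecip_neg)
next
  case False
  then obtain n where n: "k = int n" by (metis int_nat_eq not_less)
  have "qpoch q q (k + 1) = qpoch q q k * (1 - q powi (k + 1))"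
    using qpoch_Suc[OF qpoch_inf_q_nonzero, of n] by (simp add: n add.commute power_int_add q0)
  moreover have "qpoch q q (k + 1) \<noteq> 0" using False qpoch_q_eq_0_iff by simp
  ultimately show ?thesis by (simp add: qrecip_def)
qed

lemma qbinom_qrecip: "qbinom q N i = qpoch q q (int N) * qrecip q i * qrecip q (int N - i)"
  using qrecip_neg[of i] qrecip_neg[of "int N - i"]
  by (auto simp: qbinom_def qrecip_def)

text \<open>With x = q^i and y = q^{N+1-i} the two forms are the splittings 1 - xy = x(1 - y) + (1 -
  x) = (1 - y) + y(1 - x).\<close>

lemma qbinom_Pascal:
  "qbinom q (Suc N) i = q powi i * qbinom q N i + qbinom q N (i - 1)"
  "qbinom q (Suc N) i = qbinom q N i + q powi (int N + 1 - i) * qbinom q N (i - 1)"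
proof -
  define x y where "x = q powi i" and "y = q powi (int N + 1 - i)"
  have xy: "q powi (int N + 1) = x * y" by (simp add: x_def y_def q0 flip: power_int_add)
  have *: "qpoch q q (int (Suc N)) = qpoch q q (int N) * (1 - x * y)"
    using qpoch_Suc[OF qpoch_inf_q_nonzero, of N] xy by (simp add: power_int_add q0 mult.commute)
  have e1: "qrecip q (i - 1) = qrecip q i * (1 - x)"
    using qrecip_rec[of "i - 1"] by (simp add: x_def)
  have e2: "qrecip q (int N - i) = qrecip q (int N + 1 - i) * (1 - y)"
    using qrecip_rec[of "int N - i"] by (simp add: y_def algebra_simps)
  have e3: "qrecip q (int (Suc N) - i) = qrecip q (int N + 1 - i)"
    "qrecip q (int N - (i - 1)) = qrecip q (int N + 1 - i)"
    by (simp_all add: algebra_simps)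
  show "qbinom q (Suc N) i = q powi i * qbinom q N i + qbinom q N (i - 1)"
    unfolding qbinom_qrecip * e1 e2 e3 x_def[symmetric] by algebra
  show "qbinom q (Suc N) i = qbinom q N i + q powi (int N + 1 - i) * qbinom q N (i - 1)"
    unfolding qbinom_qrecip * e1 e2 e3 y_def[symmetric] by algebra
qed

lemma qgeneric_mult: "qgeneric q x \<Longrightarrow> qgeneric q (x * q)"
  using qgeneric_shift[OF q0, of x 1] by simp

lemma qgenericD: "qgeneric q x \<Longrightarrow> 1 - x * q powi k \<noteq> 0"
  by (simp add: qgeneric_def eq_commute[of 1])

lemma qgenericD0: "qgeneric q x \<Longrightarrow> 1 - x \<noteq> 0"
  using qgenericD[of x 0] by simp

subsection \<open>Changing the base point of the kernel\<close>

text \<open>The case N = 1 of the base change. With R = q^r and X = q^{j-r} it rests on (1 - bqXR^2)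
  - (1 - X) = X(1 - bqR^2).\<close>

lemma qkernel_step:
  assumes b: "qgeneric q b"
  shows "q powi j * qkernel q (b * q) j r =
    q powi r * (1 - b * q) / (1 - b * q powi (2 * r + 1)) * (qkernel q b j r - qkernel q b j (r + 1))"
proof -
  define R X E P P' where "R = q powi r" and "X = q powi (j - r)" and "E = qrecip q (j - r)"
    and "P = qpoch q (b * q) (j + r)" and "P' = qpoch q (b * q * q) (j + r)"
  have bq: "qgeneric q (b * q)" "qgeneric q (b * q * q)"
    using b by (simp_all add: qgeneric_mult)
  have pw: "q powi j = R * X" "q powi (j + r) = X * R * R" "q powi (2 * r + 1) = q * R * R"
    by (simp_all add: R_def X_def q0 power_int_diff power_int_add powi_double)
  have "qpoch q (b * q) (1 + (j + r)) = (1 - b * q) * P'"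
    using qpoch_generic_add[OF bq(1), of 1 "j + r"]
      qpoch_1[OF qpoch_inf_generic[OF bq(1)]] by (simp add: P'_def)
  moreover have top: "qpoch q (b * q) (j + r + 1) = P * (1 - b * q * X * R * R)"
    using qpoch_generic_rec[OF bq(1), of "j + r"] pw by (simp add: P_def mult_ac)
  ultimately have PP: "(1 - b * q) * P' = P * (1 - b * q * X * R * R)"
    by (simp add: add_ac)
  have "P \<noteq> 0" "P' \<noteq> 0" "1 - b * q \<noteq> 0"
    using qpoch_nonzero[OF bq(1)] qpoch_nonzero[OF bq(2)] qgenericD0[OF bq(1)]
    by (simp_all add: P_def P'_def)
  moreover have "1 - b * q * R * R \<noteq> 0"
    using qgenericD[OF b, of "2 * r + 1"] unfolding pw by (simp add: mult_ac)
  moreover have "1 - b * q * X * R * R \<noteq> 0"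
    using qgenericD[OF bq(1), of "j + r"] unfolding pw by (simp add: mult_ac)
  ultimately have nz: "P \<noteq> 0" "P' \<noteq> 0" "1 - b * q * R * R \<noteq> 0" "1 - b * q * X * R * R \<noteq> 0" "1 - b * q \<noteq> 0"
    by auto
  have E1: "qrecip q (j - (r + 1)) = E * (1 - X)"
    using qrecip_rec[of "j - r - 1"] by (simp add: E_def X_def algebra_simps)
  have k: "qkernel q (b * q) j r = E / P'" "qkernel q b j r = E / P"
    "qkernel q b j (r + 1) = E * (1 - X) / (P * (1 - b * q * X * R * R))"
    using top E1 by (simp_all add: qkernel_def E_def P_def P'_def add_ac)
  have P'_eq: "P' = P * (1 - b * q * X * R * R) / (1 - b * q)"
    using PP nz by (simp add: field_simps)
  define u where "u = 1 - b * q * X * R * R"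
  have "E / P - E * (1 - X) / (P * u) = E * X * (1 - b * q * R * R) / (P * u)"
    using nz by (simp add: divide_simps u_def) algebra
  then show ?thesis
    unfolding pw k P'_eq u_def[symmetric] R_def[symmetric] using nz
    by (simp add: mult_ac u_def[symmetric])
qed

text \<open>Over the common denominator (y)_{N+2} this is the first Pascal rule minus y q^i times
  the second.\<close>

lemma qbinom_over_qpoch_rec:
  assumes y: "qgeneric q y"
  shows "(1 - y * q powi i) * qbinom q (Suc N) i / qpoch q y (int N + 2)
    = q powi i * qbinom q N i / qpoch q (y * q) (int N + 1) + qbinom q N (i - 1) / qpoch q y (int N + 1)"
proof -
  define U V W where "U = qpoch q (y * q) (int N + 1)" and "V = qpoch q y (int N + 1)"
    and "W = q powi (int N + 1)"
  have "qpoch q y (1 + (int N + 1)) = (1 - y) * U"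
    using qpoch_generic_add[OF y, of 1 "int N + 1"]
      qpoch_1[OF qpoch_inf_generic[OF y]] by (simp add: U_def)
  then have T1: "qpoch q y (int N + 2) = (1 - y) * U" by (simp add: add_ac)
  have "qpoch q y (int N + 1 + 1) = V * (1 - y * W)"
    using qpoch_generic_rec[OF y, of "int N + 1"] by (simp add: V_def W_def)
  then have T2: "qpoch q y (int N + 2) = V * (1 - y * W)" by (simp add: add_ac)
  have nz: "U \<noteq> 0" "V \<noteq> 0" "1 - y \<noteq> 0" "1 - y * W \<noteq> 0"
    using qpoch_nonzero y qgeneric_mult qgenericD0 qgenericD
    by (simp_all add: U_def V_def W_def)
  have UV: "1 / U = (1 - y) / qpoch q y (int N + 2)" "1 / V = (1 - y * W) / qpoch q y (int N + 2)"
    using nz by (simp add: T1, simp add: T2)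
  have W: "q powi (int N + 1 - i) * q powi i = W"
    by (simp add: W_def q0 flip: power_int_add)
  have "(1 - y * q powi i) * qbinom q (Suc N) i
      = q powi i * qbinom q N i * (1 - y) + qbinom q N (i - 1) * (1 - y * W)"
    using qbinom_Pascal[of N i] W by algebra
  then have "(1 - y * q powi i) * qbinom q (Suc N) i / qpoch q y (int N + 2)
     = q powi i * qbinom q N i * (1 / U) + qbinom q N (i - 1) * (1 / V)"
    unfolding UV by (simp add: add_divide_distrib)
  then show ?thesis by (simp add: U_def V_def)
qed

text \<open>The recurrence that iterating \<open>qkernel_step\<close> imposes on the coefficients;
  \<open>X\<close> is the factor occurring there. Put y = b q^{2r+i} in
  \<open>qbinom_over_qpoch_rec\<close>.\<close>

lemma shift_coeff_rec:
  assumes b: "qgeneric q b"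
  defines "X \<equiv> \<lambda>r. q powi r * (1 - b * q) / (1 - b * q powi (2 * r + 1))"
  shows "shift_coeff q b (Suc N) r i = X (r + int i) * shift_coeff q (b * q) N r i
    - (if i = 0 then 0 else X (r + int i - 1) * shift_coeff q (b * q) N r (i - 1))"
proof -
  have bq: "qgeneric q (b * q)" using b by (rule qgeneric_mult)
  define y where "y = b * q powi (2 * r + int i)"
  have y: "qgeneric q y" unfolding y_def by (rule qgeneric_shift[OF q0 b])
  define B B' where "B = qpoch q (b * q) (int (Suc N))" and "B' = qpoch q (b * q * q) (int N)"
  have B: "B = (1 - b * q) * B'"
    using qpoch_generic_add[OF bq, of 1 "int N"]
      qpoch_1[OF qpoch_inf_generic[OF bq]] by (simp add: B_def B'_def)
  \<comment> \<open>The denominator of \<open>X s\<close> is exactly the leading factor of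
    \<open>shift_coeff\<close> at base bq.\<close>
  have canc: "X s * (1 - b * q * q powi t) = q powi s * (1 - b * q)" if "t = 2 * s" for s t
    using qgenericD[OF b, of "2 * s + 1"] that
    by (simp add: X_def power_int_add q0 mult_ac)
  have yq: "b * q * q powi (2 * r + int i) = y * q" by (simp add: y_def mult_ac)
  define w where "w = (\<lambda>i::nat. (-1) ^ i * q powi (int i * (int i - 1) div 2))"
  have sc: "shift_coeff q (b * q) N r k = (1 - b * q * q powi (2 * r + 2 * int k)) *
      (B' * w k * q powi (int N * r) * (qbinom q N (int k) / qpoch q (b * q * q powi (2 * r + int k)) (int N + 1)))" for k
    by (simp add: shift_coeff_def B'_def w_def power_int_add q0 mult_ac)
  have t1: "X (r + int i) * shift_coeff q (b * q) N r i
    = q powi (int N * r + r) * B * w i * (q powi int i * qbinom q N (int i) / qpoch q (y * q) (int N + 1))"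
    unfolding sc mult.assoc[of "X _", symmetric] yq B
    by (subst canc) (simp_all add: power_int_add q0)
  have t0: "shift_coeff q b (Suc N) r i
    = q powi (int N * r + r) * B * w i * ((1 - y * q powi int i) * qbinom q (Suc N) (int i) / qpoch q y (int N + 2))"
  proof -
    have "b * q powi (2 * r + 2 * int i) = y * q powi int i"
      by (simp add: y_def power_int_add q0 powi_double)
    moreover have "int (Suc N) * r + int i * (int i - 1) div 2 = (int N * r + r) + int i * (int i - 1) div 2"
      by (simp add: distrib_right)
    moreover have "int (Suc N) + 1 = int N + 2" by simp
    ultimately show ?thesis
      unfolding shift_coeff_def y_def[symmetric] B_def[symmetric] w_def
      by (simp only: power_int_add[OF disjI1[OF q0]] mult_ac times_divide_eq_left times_divide_eq_right)
  qed
  define T where "T = (if i = 0 then 0 else X (r + int i - 1) * shift_coeff q (b * q) N r (i - 1))"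
  have t2: "- T
    = q powi (int N * r + r) * B * w i * (qbinom q N (int i - 1) / qpoch q y (int N + 1))"
  proof (cases i)
    case 0
    then show ?thesis by (simp add: T_def qbinom_def)
  next
    case (Suc k)
    have ykq: "b * q * q powi (2 * r + int k) = y"
      by (simp add: y_def Suc power_int_add q0 mult_ac)
    have "int i * (int i - 1) = int k * (int k - 1) + 2 * int k"
      by (simp add: Suc algebra_simps)
    then have "w i = - (q powi int k) * w k"
      by (simp add: w_def Suc power_int_add q0)
    then show ?thesis
      unfolding T_def sc B
      by (simp add: Suc ykq mult.assoc[of "X _", symmetric])
        (subst canc, simp_all add: power_int_add q0)
  qed
  show ?thesis
    unfolding T_def[symmetric] t0 t1 qbinom_over_qpoch_rec[OF y] distrib_left t2[symmetric] by simp
qed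

text \<open>Induction on N for all b: since b q^{N+1} = (bq) q^N, the hypothesis at bq reaches
  kernels of base bq, and \<open>qkernel_step\<close> lowers these to base b.\<close>

lemma qkernel_shift:
  assumes "qgeneric q b"
  shows "q powi (j * int N) * qkernel q (b * q powi int N) j r
    = (\<Sum>i\<le>N. shift_coeff q b N r i * qkernel q b j (r + int i))"
  using assms
proof (induction N arbitrary: b)
  case 0
  have "qgeneric q (b * q powi (2 * r))" by (rule qgeneric_shift[OF q0 0])
  then show ?case
    using qpoch_1[OF qpoch_inf_generic] qgenericD0
      qpoch_0[OF qpoch_inf_generic[OF qgeneric_mult[OF 0]]]
    by (simp add: shift_coeff_def qbinom_qrecip qrecip_0
        qpoch_0[OF qpoch_inf_q_nonzero])
next
  case (Suc N)
  define X where "X = (\<lambda>r. q powi r * (1 - b * q) / (1 - b * q powi (2 * r + 1)))"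
  define c where "c = shift_coeff q (b * q) N r"
  define u where "u = (\<lambda>i. qkernel q b j (r + int i))"
  have "q powi (j * int (Suc N)) * qkernel q (b * q powi int (Suc N)) j r
      = q powi j * (q powi (j * int N) * qkernel q (b * q * q powi int N) j r)"
    by (simp add: algebra_simps power_int_add q0)
  also have "\<dots> = (\<Sum>i\<le>N. c i * (q powi j * qkernel q (b * q) j (r + int i)))"
    unfolding Suc.IH[OF qgeneric_mult[OF Suc.prems]] by (simp add: sum_distrib_left c_def mult_ac)
  also have "\<dots> = (\<Sum>i\<le>N. X (r + int i) * c i * u i - X (r + int i) * c i * u (Suc i))"
  proof (intro sum.cong refl)
    fix i
    have "r + int i + 1 = r + int (Suc i)" by simp
    then have "q powi j * qkernel q (b * q) j (r + int i) = X (r + int i) * (u i - u (Suc i))"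
      unfolding qkernel_step[OF Suc.prems] X_def u_def by metis
    then show "c i * (q powi j * qkernel q (b * q) j (r + int i))
      = X (r + int i) * c i * u i - X (r + int i) * c i * u (Suc i)"
      by (simp add: right_diff_distrib mult_ac)
  qed
  also have "\<dots> = (\<Sum>i\<le>N. X (r + int i) * c i * u i) - (\<Sum>i\<le>N. X (r + int i) * c i * u (Suc i))"
    by (simp add: sum_subtractf)
  \<comment> \<open>The q-binomial in \<open>c (Suc N)\<close> is 0, so both sums can run up to N +
    1 and be compared termwise.\<close>
  also have "(\<Sum>i\<le>N. X (r + int i) * c i * u i) = (\<Sum>i\<le>Suc N. X (r + int i) * c i * u i)"
  proof -
    have "c (Suc N) = 0" by (simp add: c_def shift_coeff_def qbinom_def)
    then show ?thesis by simp
  qed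
  also have "(\<Sum>i\<le>N. X (r + int i) * c i * u (Suc i))
      = (\<Sum>i\<le>Suc N. (if i = 0 then 0 else X (r + int i - 1) * c (i - 1)) * u i)"
    by (subst sum.atMost_Suc_shift) simp
  also have "(\<Sum>i\<le>Suc N. X (r + int i) * c i * u i) - \<dots> = (\<Sum>i\<le>Suc N. shift_coeff q b (Suc N) r i * u i)"
    unfolding shift_coeff_rec[OF Suc.prems] sum_subtractf[symmetric] X_def[symmetric] c_def[symmetric]
    by (intro sum.cong) (auto simp: X_def left_diff_distrib)
  finally show ?case by (simp add: u_def)
qed

subsection \<open>The q-Pfaff-Saalschuetz sum\<close>

text \<open>The terminating balanced 3phi2 sum: for z nonzero, z^k (z)_{L-k} / (q)_{L-k} is (z)_L /
  (q)_L times q^k (q^{-L})_k / (q^{1-L}/z)_k. The proof is by induction on L.\<close>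

lemma q_Pfaff_Saalschuetz:
  assumes gen: "qgeneric q A" "qgeneric q B" "qgeneric q (A * z)" "qgeneric q (B * z)"
      "qgeneric q (A * B * z)"
    and z: "qpoch_inf q z \<noteq> 0"
  shows "(\<Sum>k\<le>L. qpoch q A (int k) * qpoch q B (int k) * z ^ k * qpoch q z (int (L - k))
            * qrecip q (int k) * qrecip q (int (L - k)) / qpoch q (A * B * z) (int k))
    = qpoch q (A * z) (int L) * qpoch q (B * z) (int L) * qrecip q (int L) / qpoch q (A * B * z) (int L)"
proof -
  define p where "p = (\<lambda>x k. qpoch q x (int k))"
  define e where "e = (\<lambda>k. qrecip q (int k))"
  define c where "c = A * B * z"
  define t where "t = (\<lambda>L k. p A k * p B k * z ^ k * p z (L - k) * e k * e (L - k) / p c k)"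
  have p_Suc: "p x (Suc k) = p x k * (1 - x * q ^ k)" if "qpoch_inf q x \<noteq> 0" for x k
    using qpoch_Suc[OF that] by (simp add: p_def)
  note recs = p_Suc[OF qpoch_inf_generic[OF gen(1)]] p_Suc[OF qpoch_inf_generic[OF gen(2)]]
    p_Suc[OF qpoch_inf_generic[OF gen(3)]] p_Suc[OF qpoch_inf_generic[OF gen(4)]]
    p_Suc[OF qpoch_inf_generic[OF gen(5)], folded c_def] p_Suc[OF z]
  have e_Suc: "e k = e (Suc k) * (1 - q * q ^ k)" for k
    using qrecip_rec[of "int k"] by (simp add: e_def power_int_add q0 add_ac)
  have c_nz: "p c k \<noteq> 0" "1 - c * q ^ k \<noteq> 0" for k
    using qpoch_nonzero[OF gen(5)] qgenericD[OF gen(5), of "int k"] by (simp_all add: p_def c_def)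
  have q_nz: "1 - q * q ^ k \<noteq> 0" for k
    using q_power_Suc_neq_1[of k] by simp
  have "(\<Sum>k\<le>L. t L k) = p (A * z) L * p (B * z) L * e L / p c L"
  proof (induction L)
    case 0
    show ?case
      using qpoch_0[OF qpoch_inf_generic] qpoch_0[OF z] gen
      by (simp add: t_def p_def e_def c_def qrecip_0)
  next
    case (Suc L)
    define y where "y = q ^ L"
    \<comment> \<open>H is the q-Zeilberger certificate: the recurrence in L telescopes in k.\<close>
    define H where "H = (\<lambda>k. - (q ^ (Suc L - k)) * t (Suc L) k * (1 - q ^ k) * (1 - c * q ^ k / q))"
    have step: "(1 - q * y) * (1 - c * y) * t (Suc L) k - (1 - A * z * y) * (1 - B * z * y) * t L k
        = H (Suc k) - H k" if kL: "k \<le> L" for k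
    proof -
      obtain d where L: "L = k + d" using le_Suc_ex[OF kL] by blast
      define x w where "x = q ^ k" and "w = q ^ d"
      have y: "y = x * w" by (simp add: y_def x_def w_def L power_add)
      \<comment> \<open>\<open>Q\<close> divides all four terms of the recurrence, which leaves a
        polynomial identity in x and w. Taking \<open>e (Suc d)\<close> into it lets
        \<open>e d\<close> be expressed without division.\<close>
      define Q where "Q = p A k * p B k * z ^ k * p z d * e k * e (Suc d) / p c k"
      have t1: "t (Suc L) k = Q * (1 - z * w)"
        using recs(6)[of d] by (simp add: t_def Q_def L Suc_diff_le w_def)
      have t2: "t L k = Q * (1 - q * w)"
        using e_Suc[of d] by (simp add: t_def Q_def L w_def)
      have "t (Suc L) (Suc k) * ((1 - q * x) * (1 - c * x))
          = p A k * (1 - A * x) * (p B k * (1 - B * x)) * (z * z ^ k) * p z d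
            * (e (Suc k) * (1 - q * x)) * e d / p c k"
        using recs(1)[of k] recs(2)[of k] recs(5)[of k] c_nz[of k]
        by (simp add: t_def L x_def)
      also have "\<dots> = Q * ((1 - A * x) * (1 - B * x) * z * (1 - q * w))"
        using e_Suc[of k] e_Suc[of d] by (simp add: Q_def x_def w_def)
      finally have t3: "t (Suc L) (Suc k) * ((1 - q * x) * (1 - c * x))
          = Q * ((1 - A * x) * (1 - B * x) * z * (1 - q * w))" .
      have H1: "H (Suc k) = - w * (Q * ((1 - A * x) * (1 - B * x) * z * (1 - q * w)))"
        unfolding t3[symmetric] by (simp add: H_def L w_def x_def q0)
      have H0: "H k = - (q * w) * (Q * (1 - z * w)) * (1 - x) * (1 - c * x / q)"
        unfolding t1[symmetric] by (simp add: H_def L w_def x_def Suc_diff_le)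
      have H0': "H k = - w * (Q * (1 - z * w)) * (1 - x) * (q - c * x)"
        unfolding H0 using q0 by (simp add: field_simps)
      show ?thesis unfolding t1 t2 H1 H0' y c_def by algebra
    qed
    have "(1 - q * y) * (1 - c * y) * (\<Sum>k\<le>L. t (Suc L) k) - (1 - A * z * y) * (1 - B * z * y) * (\<Sum>k\<le>L. t L k)
        = (\<Sum>k\<le>L. H (Suc k) - H k)"
      unfolding sum_distrib_left sum_subtractf[symmetric] by (intro sum.cong refl step) auto
    also have "\<dots> = H (Suc L) - H 0" 
      unfolding lessThan_Suc_atMost[symmetric] by (rule sum_lessThan_telescope)
    \<comment> \<open>\<open>H 0\<close> vanishes by its factor 1 - q^0, and
      \<open>H (Suc L)\<close> supplies the missing summand k = L + 1 with the opposite
      sign.\<close>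
    also have "\<dots> = - (1 - q * y) * (1 - c * y) * t (Suc L) (Suc L)"
      by (simp add: H_def y_def q0) algebra
    finally have rec: "(1 - q * y) * (1 - c * y) * (\<Sum>k\<le>Suc L. t (Suc L) k)
        = (1 - A * z * y) * (1 - B * z * y) * (\<Sum>k\<le>L. t L k)"
      by (simp add: algebra_simps)
    have "(1 - q * y) * (1 - c * y) \<noteq> 0"
      using q_nz[of L] c_nz(2)[of L] by (simp add: y_def)
    then have "(\<Sum>k\<le>Suc L. t (Suc L) k)
        = (1 - A * z * y) * (1 - B * z * y) * (p (A * z) L * p (B * z) L * e L / p c L) / ((1 - q * y) * (1 - c * y))"
      unfolding rec[unfolded Suc.IH, symmetric] by (rule nonzero_mult_div_cancel_left[symmetric])
    also have "\<dots> = p (A * z) (Suc L) * p (B * z) (Suc L) * e (Suc L) / p c (Suc L)"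
      using e_Suc[of L] recs(3)[of L] recs(4)[of L] recs(5)[of L] q_nz[of L] c_nz[of L]
      by (simp add: y_def mult_ac)
    finally show ?case .
  qed
  then show ?thesis by (simp add: t_def p_def e_def c_def)
qed

text \<open>The evaluation of T(n, m): putting j = m + k gives the q-Pfaff-Saalschuetz sum with A =
  rho q^m, B = sigma q^m and ABz = b q^{2m+1}. The index 0 in \<open>lattice_weight\<close> removes
  the factor q^{jN}.\<close>

lemma Bailey_lemma_kernel:
  fixes \<rho> \<sigma> b :: complex
  defines "z \<equiv> b * q / (\<rho> * \<sigma>)"
  assumes nz: "b \<noteq> 0" "\<rho> \<noteq> 0" "\<sigma> \<noteq> 0"
    and gen: "qgeneric q \<rho>" "qgeneric q \<sigma>" "qgeneric q (b * q / \<rho>)" "qgeneric q (b * q / \<sigma>)" "qgeneric q b"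
    and z: "qpoch_inf q z \<noteq> 0" and mn: "m \<le> n"
  shows "(\<Sum>j=m..n. lattice_weight q b 0 \<rho> \<sigma> n j * qkernel q b j m)
    = qpoch q \<rho> m * qpoch q \<sigma> m * z powi m / (qpoch q (b * q / \<rho>) m * qpoch q (b * q / \<sigma>) m) * qkernel q b n m"
proof -
  define L where "L = nat (n - m)"
  have n: "n = m + int L" using mn by (simp add: L_def)
  define M where "M = q powi m"
  define A B where "A = \<rho> * M" and "B = \<sigma> * M"
  have z0: "z \<noteq> 0" using nz q0 by (simp add: z_def)
  have Az: "A * z = b * q / \<sigma> * M" "B * z = b * q / \<rho> * M" "A * B * z = b * q * q powi (2 * m)"
    using nz by (simp_all add: A_def B_def z_def M_def powi_double power_int_add q0)
  have bq: "qgeneric q (b * q)" using gen(5) by (rule qgeneric_mult)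
  have gAB: "qgeneric q A" "qgeneric q B" "qgeneric q (A * z)" "qgeneric q (B * z)" "qgeneric q (A * B * z)"
    unfolding Az unfolding A_def B_def M_def by (intro qgeneric_shift[OF q0] gen bq)+
  note S = q_Pfaff_Saalschuetz[OF gAB z, of L]
  \<comment> \<open>\<open>K\<close> collects all factors that do not depend on the summation index
    k.\<close>
  define K where "K = qpoch q \<rho> m * qpoch q \<sigma> m * z powi m / (qpoch q (b * q / \<rho>) n * qpoch q (b * q / \<sigma>) n)
     / qpoch q (b * q) (2 * m)"
  have zz: "z powi (m + int k) = z powi m * z ^ k" for k
    using z0 by (simp add: power_int_add)
  have "(\<Sum>j=m..n. lattice_weight q b 0 \<rho> \<sigma> n j * qkernel q b j m)
     = (\<Sum>k\<le>L. lattice_weight q b 0 \<rho> \<sigma> n (m + int k) * qkernel q b (m + int k) m)"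
    by (rule sum.reindex_bij_witness[of _ "\<lambda>k. m + int k" "\<lambda>j. nat (j - m)"]) (auto simp: n)
  also have "\<dots> = (\<Sum>k\<le>L. K * (qpoch q A (int k) * qpoch q B (int k) * z ^ k * qpoch q z (int (L - k))
            * qrecip q (int k) * qrecip q (int (L - k)) / qpoch q (A * B * z) (int k)))"
  proof (intro sum.cong refl)
    fix k assume "k \<in> {..L}"
    then have k: "n - (m + int k) = int (L - k)" by (simp add: n)
    have r: "qpoch q \<rho> (m + int k) = qpoch q \<rho> m * qpoch q A (int k)"
      "qpoch q \<sigma> (m + int k) = qpoch q \<sigma> m * qpoch q B (int k)"
      "qpoch q (b * q) (2 * m + int k) = qpoch q (b * q) (2 * m) * qpoch q (A * B * z) (int k)"
      unfolding Az unfolding A_def B_def M_def by (intro qpoch_generic_add gen bq)+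
    define E D where "E = qpoch q (b * q) (2 * m)" and "D = qpoch q (A * B * z) (int k)"
    have "qpoch q (b * q) (m + int k + m) = E * D"
      unfolding E_def D_def r(3)[symmetric] by (rule arg_cong[of _ _ "qpoch q (b * q)"]) simp
    then show "lattice_weight q b 0 \<rho> \<sigma> n (m + int k) * qkernel q b (m + int k) m =
       K * (qpoch q A (int k) * qpoch q B (int k) * z ^ k * qpoch q z (int (L - k))
            * qrecip q (int k) * qrecip q (int (L - k)) / qpoch q (A * B * z) (int k))"
      unfolding lattice_weight_def qkernel_def k r D_def[symmetric] K_def E_def[symmetric]
      by (simp add: zz qrecip_def z_def[symmetric] mult_ac)
  qed
  also have "\<dots> = K * (qpoch q (A * z) (int L) * qpoch q (B * z) (int L) * qrecip q (int L) / qpoch q (A * B * z) (int L))"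
    unfolding S[symmetric] by (simp add: sum_distrib_left)
  also have "\<dots> = qpoch q \<rho> m * qpoch q \<sigma> m * z powi m / (qpoch q (b * q / \<rho>) m * qpoch q (b * q / \<sigma>) m) * qkernel q b n m"
  proof -
    have r: "qpoch q (b * q / \<rho>) n = qpoch q (b * q / \<rho>) m * qpoch q (B * z) (int L)"
      "qpoch q (b * q / \<sigma>) n = qpoch q (b * q / \<sigma>) m * qpoch q (A * z) (int L)"
      "qpoch q (b * q) (2 * m + int L) = qpoch q (b * q) (2 * m) * qpoch q (A * B * z) (int L)"
      unfolding Az unfolding A_def B_def M_def n by (intro qpoch_generic_add gen bq)+
    have nm: "n - m = int L" "n + m = 2 * m + int L" by (simp_all add: n)
    have "qpoch q (A * z) (int L) \<noteq> 0" "qpoch q (B * z) (int L) \<noteq> 0"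
      using gAB qpoch_nonzero by blast+
    then show ?thesis
      unfolding qkernel_def nm r K_def by (simp add: mult.assoc)
  qed
  finally show ?thesis .
qed

subsection \<open>Growth at minus infinity\<close>

lemma tendsto_powi_at_bot: "((\<lambda>r. q powi (c - r)) \<longlongrightarrow> 0) at_bot"
proof -
  have "filterlim (\<lambda>r::int. nat (- r)) sequentially at_bot"
    unfolding filterlim_at_top eventually_at_bot_linorder
  proof
    fix Z
    show "\<exists>N. \<forall>n\<le>N. Z \<le> nat (- n)" by (rule exI[of _ "- int Z"]) auto
  qed
  from filterlim_compose[OF LIMSEQ_power_zero[OF q1] this]
  have "((\<lambda>r. q powi c * q ^ nat (- r)) \<longlongrightarrow> q powi c * 0) at_bot"
    by (intro tendsto_mult tendsto_const)
  moreover have "eventually (\<lambda>r::int. q powi c * q ^ nat (- r) = q powi (c - r)) at_bot"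
    using eventually_le_at_bot[of 0]
  proof eventually_elim
    case (elim r)
    have "q powi (c - r) = q powi c * q powi int (nat (- r))"
      using elim by (simp add: q0 flip: power_int_add)
    then show ?case by (simp only: power_int_of_nat)
  qed
  ultimately show ?thesis by (simp add: filterlim_cong)
qed

text \<open>A step down removes one linear factor above and one below. Multiplied by q^{-r}, which
  tends to 0, their quotient becomes (q^{-r} - Y) / (q^{-r} - X) and tends to Y / X.\<close>

lemma ratio_at_bot_qpoch_quotient:
  assumes "qgeneric q x" "qgeneric q y" "x \<noteq> 0"
  shows "ratio_at_bot (\<lambda>r. qpoch q x (r + s) / qpoch q y (r + t)) (y / x * q powi (t - s))"
proof -
  define X Y where "X = x * q powi (s - 1)" and "Y = y * q powi (t - 1)"
  have eq: "qpoch q x (r - 1 + s) / qpoch q y (r - 1 + t) / (qpoch q x (r + s) / qpoch q y (r + t))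
      = (q powi (0 - r) - Y) / (q powi (0 - r) - X)" for r
  proof -
    have *: "qpoch q w (r + u) = qpoch q w (r - 1 + u) * (1 - w * q powi (r - 1 + u))" if "qgeneric q w" for w u
      using qpoch_generic_rec[OF that, of "r - 1 + u"] by simp
    define P where "P = q powi (0 - r)"
    have P: "q powi (r - 1 + u) = q powi (u - 1) / P" for u
      by (simp add: P_def power_int_diff power_int_add power_int_minus q0 field_simps)
    have "1 - w * q powi (r - 1 + u) = (P - w * q powi (u - 1)) / P" for w u
      unfolding P by (simp add: P_def diff_divide_distrib q0)
    then have "(1 - y * q powi (r - 1 + t)) / (1 - x * q powi (r - 1 + s)) = (P - Y) / (P - X)"
      by (simp add: X_def Y_def P_def q0)
    moreover have "qpoch q x (r - 1 + s) \<noteq> 0" "qpoch q y (r - 1 + t) \<noteq> 0"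
      using assms qpoch_nonzero by auto
    ultimately show ?thesis
      unfolding *[OF assms(1)] *[OF assms(2)] P_def[symmetric] by simp
  qed
  have X: "X \<noteq> 0" using assms by (simp add: X_def q0)
  have "((\<lambda>r. (q powi (0 - r) - Y) / (q powi (0 - r) - X)) \<longlongrightarrow> (0 - Y) / (0 - X)) at_bot"
    using X by (intro tendsto_divide tendsto_diff tendsto_powi_at_bot tendsto_const) auto
  moreover have "(0 - Y) / (0 - X) = y / x * q powi (t - s)"
    by (simp add: X_def Y_def power_int_diff q0 field_simps)
  ultimately show ?thesis
    unfolding ratio_at_bot_def eq by simp
qed

lemma ratio_at_bot_qrecip: "ratio_at_bot (\<lambda>r. qrecip q (s - r)) 1"
proof -
  have "((\<lambda>r. 1 / (1 - q powi (s + 1 - r))) \<longlongrightarrow> 1 / (1 - 0)) at_bot"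
    by (intro tendsto_divide tendsto_diff tendsto_powi_at_bot tendsto_const) auto
  moreover have "eventually (\<lambda>r. 1 / (1 - q powi (s + 1 - r)) = qrecip q (s - (r - 1)) / qrecip q (s - r)) at_bot"
    using eventually_le_at_bot[of s]
  proof eventually_elim
    case (elim r)
    have "qrecip q (s - r) = qrecip q (s - (r - 1)) * (1 - q powi (s + 1 - r))"
      using qrecip_rec[of "s - r"] by (simp add: algebra_simps)
    moreover have "qrecip q (s - (r - 1)) \<noteq> 0"
      using elim qrecip_nonzero by simp
    ultimately show ?case by simp
  qed
  ultimately show ?thesis
    by (simp add: ratio_at_bot_def filterlim_cong)
qed

text \<open>Only the existence of a limit matters: its value is later outweighed by a high power of
  q.\<close>

lemma ratio_at_bot_shift_coeff:
  assumes b: "qgeneric q b" "b \<noteq> 0" and i: "i \<le> N"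
  shows "\<exists>l. ratio_at_bot (\<lambda>r. shift_coeff q b N r i) l"
proof -
  define c where "c = qpoch q (b * q) (int N) * (-1) ^ i * q powi (int i * (int i - 1) div 2) * qbinom q N (int i)"
  have c: "c \<noteq> 0"
    using i qpoch_nonzero[OF qgeneric_mult[OF b(1)]] qpoch_q_eq_0_iff
    by (simp add: c_def q0 qbinom_def)
  \<comment> \<open>At k = 2r, \<open>f\<close> is the factor 1 - b q^{2r+2i} and \<open>g\<close>
    is 1/(b q^{2r+i})_{N+1}, both written as quotients of symbols with the same base b.\<close>
  define f where "f = (\<lambda>k::int. qpoch q b (k + (2 * int i + 1)) / qpoch q b (k + 2 * int i))"
  define g where "g = (\<lambda>k::int. qpoch q b (k + int i) / qpoch q b (k + (int i + (int N + 1))))"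
  obtain lf lg where "ratio_at_bot f lf" "ratio_at_bot g lg"
    unfolding f_def g_def using ratio_at_bot_qpoch_quotient[OF b(1) b(1) b(2)] by blast
  moreover have nz: "f k \<noteq> 0" "g k \<noteq> 0" for k
    using qpoch_nonzero[OF b(1)] by (simp_all add: f_def g_def)
  ultimately have "ratio_at_bot (\<lambda>r. f (2 * r) * g (2 * r)) ((lf * lf) * (lg * lg))"
    by (intro ratio_at_bot_mult ratio_at_bot_double)
  from ratio_at_bot_mult[OF ratio_at_bot_const[OF c] ratio_at_bot_mult[OF this ratio_at_bot_powi[of "q ^ N"]]]
  have "ratio_at_bot (\<lambda>r. c * (f (2 * r) * g (2 * r) * (q ^ N) powi r)) (1 * (lf * lf * (lg * lg) * inverse (q ^ N)))"
    by (simp add: q0)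
  moreover have "shift_coeff q b N r i = c * (f (2 * r) * g (2 * r) * (q ^ N) powi r)" for r
  proof -
    have f: "f (2 * r) = 1 - b * q powi (2 * r + 2 * int i)"
      using qpoch_generic_rec[OF b(1), of "2 * r + 2 * int i"] qpoch_nonzero[OF b(1)]
      by (simp add: f_def add.assoc)
    have g: "g (2 * r) = 1 / qpoch q (b * q powi (2 * r + int i)) (int N + 1)"
      using qpoch_generic_add[OF b(1), of "2 * r + int i" "int N + 1"] qpoch_nonzero[OF b(1)]
      by (simp add: g_def add.assoc)
    have "q powi (int N * r) = (q ^ N) powi r"
      by (metis power_int_mult power_int_of_nat)
    then show ?thesis
      unfolding f g c_def shift_coeff_def power_int_add[OF disjI1[OF q0], of "int N * r"] by simp
  qed
  ultimately show ?thesis by auto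
qed

end

section \<open>Bailey pairs\<close>

text \<open>Both weights contain the same parameter a q^{1-N} = bq, so they differ by q^{jN}
  alone.\<close>

lemma lattice_weight_shift:
  assumes "q \<noteq> 0"
  shows "lattice_weight q a N \<rho> \<sigma> n j
    = lattice_weight q (a * q powi (- int N)) 0 \<rho> \<sigma> n j * q powi (j * int N)"
proof -
  have eq: "a * q powi (1 - int N) = a * q powi (- int N) * q powi (1 - int 0)"
    using assms by (simp add: power_int_diff power_int_minus field_simps)
  show ?thesis unfolding lattice_weight_def eq by simp
qed

lemma bailey_term_qkernel: "bailey_term q c \<alpha> n j = \<alpha> j * qkernel q c n j"
  by (simp add: bailey_term_def qkernel_def qrecip_def)

theorem theorem3p5:
  fixes a q \<rho> \<sigma> :: complex and \<alpha> \<beta> :: "int \<Rightarrow> complex" and N :: nat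
  assumes q: "q \<noteq> 0" "norm q < 1"
    and nonzero: "a \<noteq> 0" "\<rho> \<noteq> 0" "\<sigma> \<noteq> 0"
    and generic_a: "\<And>k::int. a * q powi k \<noteq> 1"
    and generic_rho: "\<And>k::int. \<rho> * q powi k \<noteq> 1" "\<And>k::int. a / \<rho> * q powi k \<noteq> 1"
    and generic_sigma: "\<And>k::int. \<sigma> * q powi k \<noteq> 1" "\<And>k::int. a / \<sigma> * q powi k \<noteq> 1"
    and generic_rho_sigma: "\<And>k::nat. a * q powi (1 - int N) / (\<rho> * \<sigma>) * q ^ k \<noteq> 1"
    and pair: "bilateral_bailey_pair q a \<alpha> \<beta>"
    and abs_conv: "\<And>n::int. (\<lambda>(j, r). norm (lattice_weight q a N \<rho> \<sigma> n j * bailey_term q a \<alpha> j r))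
                     summable_on {(j, r). r \<le> j \<and> j \<le> n}"
  shows "bilateral_bailey_pair q (a * q powi (- int N))
           (lattice_alpha q a N \<rho> \<sigma> \<alpha>) (lattice_beta q a N \<rho> \<sigma> \<beta>)"
proof -

  \<comment> \<open>Parameters and genericity\<close>
  define b where "b = a * q powi (- int N)"
  define z where "z = b * q / (\<rho> * \<sigma>)"
  have a_eq: "a = b * q powi int N"
    using q by (simp add: b_def power_int_minus)
  have bq: "a * q powi (1 - int N) = b * q"
    using q by (simp add: b_def power_int_diff power_int_minus field_simps)
  have b0: "b \<noteq> 0" and z0: "z \<noteq> 0"
    using nonzero q by (simp_all add: b_def z_def)
  have ga: "qgeneric q a" and gr: "qgeneric q \<rho>" and gs: "qgeneric q \<sigma>"
    using generic_a generic_rho generic_sigma by (simp_all add: qgeneric_def)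
  have gb: "qgeneric q b" unfolding b_def by (rule qgeneric_shift[OF q(1) ga])
  have gbr: "qgeneric q (b * q / \<rho>)"
    using qgeneric_shift[OF q(1), of "a / \<rho>" "1 - int N"] generic_rho(2)
    unfolding times_divide_eq_left bq by (simp add: qgeneric_def nonzero)
  have gbs: "qgeneric q (b * q / \<sigma>)"
    using qgeneric_shift[OF q(1), of "a / \<sigma>" "1 - int N"] generic_sigma(2)
    unfolding times_divide_eq_left bq by (simp add: qgeneric_def nonzero)
  have zk: "z * q ^ k \<noteq> 1" for k
    using generic_rho_sigma[of k] by (simp add: z_def bq)
  then have ginf: "qpoch_inf q z \<noteq> 0" by (simp add: qpoch_inf_eq_0_iff[OF q])
  \<comment> \<open>Nonnegative indices suffice, since the weights contain (z)_{n-j} with j <=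
    n.\<close>
  have qpoch_z: "qpoch q z (int k) \<noteq> 0" for k
    using ginf qpoch_0[OF ginf] zk by (induction k) (simp_all only: qpoch_Suc[OF q ginf], auto)
  define W where "W = lattice_weight q a N \<rho> \<sigma>"
  \<comment> \<open>\<open>S m\<close> is both the prefactor of alpha'_m and the quotient of T(n, m)
    by the kernel.\<close>
  define S where "S = (\<lambda>m. qpoch q \<rho> m * qpoch q \<sigma> m * z powi m
    / (qpoch q (b * q / \<rho>) m * qpoch q (b * q / \<sigma>) m))"
  \<comment> \<open>\<open>f n i\<close> is the i-th of the N + 1 series into which beta'_n
    decomposes.\<close>
  define f where "f = (\<lambda>n i r. \<alpha> r * shift_coeff q b N r i * (S (r + int i) * qkernel q b n (r + int i)))"
  have qkernel_0: "qkernel q c n r = 0" if "n < r" for c n r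
    using that qrecip_neg[OF q] by (simp add: qkernel_def)
  have W_nz: "W n (n - int p) \<noteq> 0" for n p
    using qpoch_nonzero[OF q] gr gs gbr gbs qpoch_z[of p] z0 q qpoch_q_eq_0_iff[OF q]
    by (simp add: W_def lattice_weight_def bq z_def)

  \<comment> \<open>The two finite identities combined\<close>
  have kernel: "(\<Sum>j=r..n. W n j * qkernel q a j r)
      = (\<Sum>i\<le>N. shift_coeff q b N r i * (S (r + int i) * qkernel q b n (r + int i)))" if "r \<le> n" for n r
  proof -
    define V where "V = lattice_weight q b 0 \<rho> \<sigma>"
    have "W n j * qkernel q a j r = (\<Sum>i\<le>N. shift_coeff q b N r i * (V n j * qkernel q b j (r + int i)))" for j
    proof -
      have "W n j * qkernel q a j r = V n j * (q powi (j * int N) * qkernel q (b * q powi int N) j r)"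
        using lattice_weight_shift[OF q(1), of a N \<rho> \<sigma> n j]
        unfolding b_def[symmetric] a_eq[symmetric] by (simp add: W_def V_def)
      also have "\<dots> = (\<Sum>i\<le>N. shift_coeff q b N r i * (V n j * qkernel q b j (r + int i)))"
        unfolding qkernel_shift[OF q gb] sum_distrib_left by (simp add: mult_ac)
      finally show ?thesis .
    qed
    then have "(\<Sum>j=r..n. W n j * qkernel q a j r)
        = (\<Sum>i\<le>N. shift_coeff q b N r i * (\<Sum>j=r..n. V n j * qkernel q b j (r + int i)))"
      by (simp add: sum_distrib_left sum.swap[of _ "{..N}"])
    moreover have "(\<Sum>j=r..n. V n j * qkernel q b j (r + int i)) = S (r + int i) * qkernel q b n (r + int i)" for i
    proof -
      \<comment> \<open>For j < r + i the kernel is 0, so the range may start where the Saalschuetz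
        sum starts.\<close>
      have "(\<Sum>j=r..n. V n j * qkernel q b j (r + int i)) = (\<Sum>j=r + int i..n. V n j * qkernel q b j (r + int i))"
        by (rule sum.mono_neutral_right) (auto simp: qkernel_0)
      also have "\<dots> = S (r + int i) * qkernel q b n (r + int i)"
      proof (cases "r + int i \<le> n")
        case True
        show ?thesis
          using Bailey_lemma_kernel[OF q b0 nonzero(2,3) gr gs gbr gbs gb ginf[unfolded z_def] True]
          by (simp add: V_def S_def z_def)
      qed (simp add: qkernel_0)
      finally show ?thesis .
    qed
    ultimately show ?thesis by simp
  qed

  \<comment> \<open>The terms of alpha' along the diagonals m = r + i\<close>
  have alpha: "lattice_alpha q a N \<rho> \<sigma> \<alpha> m
      = S m * (\<Sum>i\<le>N. shift_coeff q b N (m - int i) i * \<alpha> (m - int i))" for m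
  proof -
    have e1: "a * q powi (2 * m - int N) = b * q powi (2 * m)"
      using q by (simp add: b_def power_int_diff power_int_minus field_simps)
    have e2: "a * q powi (2 * m - int N - int i) = b * q powi (2 * (m - int i) + int i)" for i
      using q by (simp add: b_def mult.assoc algebra_simps flip: power_int_add)
    \<comment> \<open>At r = m - i the leading factor is 1 - b q^{2m}, independent of i, and leaves
      the sum.\<close>
    have "shift_coeff q b N (m - int i) i * \<alpha> (m - int i) = (1 - b * q powi (2 * m)) * qpoch q (b * q) (int N)
      * ((-1) ^ i
          * (q powi (int N * (m - int i) + int i * (int i - 1) div 2)
             / qpoch q (a * q powi (2 * m - int N - int i)) (int N + 1))
          * qbinom q N (int i) * \<alpha> (m - int i))" for i
    proof -
      have "2 * (m - int i) + 2 * int i = 2 * m" by simp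
      then show ?thesis unfolding shift_coeff_def e2 by simp
    qed
    then show ?thesis
      unfolding lattice_alpha_def e1 bq z_def[symmetric] S_def atMost_atLeast0
      by (simp add: sum_distrib_left mult.assoc)
  qed

  have bailey': "bailey_term q b (lattice_alpha q a N \<rho> \<sigma> \<alpha>) n m = (\<Sum>i\<le>N. f n i (m - int i))" for n m
    unfolding bailey_term_qkernel alpha f_def
    by (simp add: sum_distrib_left sum_distrib_right mult_ac)

  \<comment> \<open>Absolute convergence of each separate series\<close>
  have slice: "(\<lambda>r. norm (bailey_term q a \<alpha> j r)) summable_on {..j}" if "j \<le> n" for n j
  proof -
    have "(\<lambda>(j, r). norm (W n j * bailey_term q a \<alpha> j r)) summable_on (Pair j ` {..j})"
      by (rule summable_on_subset[OF abs_conv[of n, folded W_def]]) (use that in auto)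
    then have "(\<lambda>r. norm (W n j * bailey_term q a \<alpha> j r)) summable_on {..j}"
      by (subst (asm) summable_on_reindex) (auto simp: inj_on_def o_def)
    moreover have "W n j \<noteq> 0" using W_nz[of n "nat (n - j)"] that by simp
    ultimately show ?thesis
      by (simp add: norm_mult summable_on_cmult_right')
  qed

  have f_summable: "f n i summable_on UNIV" if i: "i \<le> N" for n i
  proof -
    obtain l where l: "ratio_at_bot (\<lambda>r. shift_coeff q b N r i) l"
      using ratio_at_bot_shift_coeff[OF q gb b0 i] by blast
    \<comment> \<open>The coefficient of alpha_r in \<open>f n i\<close>, divided by its coefficient
      in beta_{n-p}; p is still free.\<close>
    define h where "h = (\<lambda>p::nat. \<lambda>r. shift_coeff q b N r i * (S (r + int i) * qkernel q b n (r + int i))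
      / qkernel q a (n - int p) r)"
    have gaq: "qgeneric q (a * q)" and gbq: "qgeneric q (b * q)"
      using ga gb qgeneric_mult[OF q] by auto
    \<comment> \<open>The part of the limit ratio that does not depend on p; (aq)_{r+n-p}
      contributes the remaining q^p.\<close>
    define \<mu> where "\<mu> = l * (z * z * inverse z * (b / a * q powi int i))"
    have ratio_h: "ratio_at_bot (h p) (\<mu> * q ^ p)" for p
    proof -
      \<comment> \<open>Pairing rho with bq/sigma, and sigma with bq/rho, gives each quotient the
        limit ratio z.\<close>
      define A1 where "A1 = (\<lambda>m. qpoch q \<rho> (m + 0) / qpoch q (b * q / \<sigma>) (m + 0))"
      define A2 where "A2 = (\<lambda>m. qpoch q \<sigma> (m + 0) / qpoch q (b * q / \<rho>) (m + 0))"
      define A3 where "A3 = (\<lambda>r. qpoch q (a * q) (r + (n - int p)) / qpoch q (b * q) (r + (n + int i)))"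
      have "ratio_at_bot A1 z" "ratio_at_bot A2 z"
        using ratio_at_bot_qpoch_quotient[OF q gr gbs nonzero(2), of 0 0]
          ratio_at_bot_qpoch_quotient[OF q gs gbr nonzero(3), of 0 0]
        by (simp_all add: A1_def A2_def z_def mult.commute)
      then have S_ratio: "ratio_at_bot (\<lambda>r. A1 (r + int i) * A2 (r + int i) * z powi (r + int i)) (z * z * inverse z)"
        by (intro ratio_at_bot_mult ratio_at_bot_shift ratio_at_bot_shift[OF ratio_at_bot_powi] z0)
      have A3_ratio: "ratio_at_bot A3 (b / a * q powi int i * q ^ p)"
        using ratio_at_bot_qpoch_quotient[OF q gaq gbq, of "n - int p" "n + int i"] nonzero q
        by (simp add: A3_def power_int_add algebra_simps)
      have rec: "ratio_at_bot (\<lambda>r. qrecip q (n - int i - r) * inverse (qrecip q (n - int p - r))) (1 * inverse 1)"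
        by (intro ratio_at_bot_mult ratio_at_bot_inverse ratio_at_bot_qrecip[OF q]) simp
      have h_eq: "h p = (\<lambda>r. shift_coeff q b N r i * (A1 (r + int i) * A2 (r + int i) * z powi (r + int i)
          * (A3 r * (qrecip q (n - int i - r) * inverse (qrecip q (n - int p - r))))))"
        by (rule ext) (simp add: h_def S_def A1_def A2_def A3_def qkernel_def field_simps)
      have "\<mu> * q ^ p = l * (z * z * inverse z * ((b / a * q powi int i * q ^ p) * (1 * inverse 1)))"
        by (simp add: \<mu>_def)
      then show ?thesis
        unfolding h_eq by (simp only:) (intro ratio_at_bot_mult l S_ratio A3_ratio rec)
    qed
    have "(\<lambda>p. norm (\<mu> * q ^ p)) \<longlonglongrightarrow> norm (\<mu> * 0)"
      by (intro tendsto_intros LIMSEQ_power_zero q)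
    then have "eventually (\<lambda>p. norm (\<mu> * q ^ p) < 1) sequentially"
      by (rule order_tendstoD) simp
    then obtain p where p: "norm (\<mu> * q ^ p) < 1"
      by (auto simp: eventually_sequentially)
    have kernel_nz: "qkernel q c m r \<noteq> 0" if "qgeneric q c" "r \<le> m" for c m r
      using that qpoch_nonzero[OF q qgeneric_mult[OF q]] qrecip_nonzero[OF q] by (simp add: qkernel_def)
    have coeff_nz: "shift_coeff q b N r i \<noteq> 0" for r
      using i qpoch_nonzero[OF q gbq] qpoch_nonzero[OF q qgeneric_shift[OF q(1) gb]] qgenericD[OF q gb]
        qpoch_q_eq_0_iff[OF q] q
      by (simp add: shift_coeff_def qbinom_def)
    have S_nz: "S m \<noteq> 0" for m
      using qpoch_nonzero[OF q] gr gs gbr gbs z0 by (simp add: S_def)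
    have "eventually (\<lambda>r. h p r \<noteq> 0) at_bot"
      using eventually_le_at_bot[of "n - int p - int i"]
      by eventually_elim (simp add: h_def coeff_nz S_nz kernel_nz ga gb)
    from ratio_at_bot_bounded[OF ratio_h p this] obtain R C where
      C: "\<And>r. r \<le> R \<Longrightarrow> norm (h p r) \<le> C" by blast
    \<comment> \<open>Below \<open>M\<close> the bound on \<open>h p\<close> holds and the kernel of
      the slice is nonzero, so \<open>f n i\<close> can be recovered from
      \<open>h p\<close>.\<close>
    define M where "M = min R (n - int p)"
    have "(\<lambda>r. norm (f n i r)) summable_on {..M}"
    proof (rule Infinite_Sum.abs_summable_on_comparison_test')
      have "(\<lambda>r. norm (bailey_term q a \<alpha> (n - int p) r)) summable_on {..M}"
        by (rule summable_on_subset[OF slice[of "n - int p" n]]) (auto simp: M_def)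
      then show "(\<lambda>r. C * norm (bailey_term q a \<alpha> (n - int p) r)) summable_on {..M}"
        by (rule summable_on_cmult_right)
    next
      fix r assume "r \<in> {..M}"
      then have r: "r \<le> R" "r \<le> n - int p" by (auto simp: M_def)
      have "f n i r = h p r * bailey_term q a \<alpha> (n - int p) r"
        using kernel_nz[OF ga r(2)] by (simp add: f_def h_def bailey_term_qkernel)
      then show "norm (f n i r) \<le> C * norm (bailey_term q a \<alpha> (n - int p) r)"
        using C[OF r(1)] by (simp add: norm_mult mult_right_mono)
    qed
    then have "f n i summable_on {..M}" by (rule abs_summable_summable)
    moreover have "f n i summable_on {M<..n}" by simp
    ultimately have "f n i summable_on ({..M} \<union> {M<..n})"
      by (rule summable_on_Un_disjoint) auto
    then show ?thesis
      by (rule summable_on_cong_neutral[THEN iffD1, rotated -1])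
        (auto simp: f_def qkernel_0)
  qed

  \<comment> \<open>Interchange of summations and regrouping\<close>
  have "(\<lambda>k. bailey_term q b (lattice_alpha q a N \<rho> \<sigma> \<alpha>) n (n - int k)) sums lattice_beta q a N \<rho> \<sigma> \<beta> n" for n
  proof -
    define F where "F = (\<lambda>(j, r). W n j * bailey_term q a \<alpha> j r)"
    have D: "{(j, r). r \<le> j \<and> j \<le> n} = Sigma {..n} (\<lambda>j. {..j})" by auto
    have "(\<lambda>x. norm (F x)) summable_on Sigma {..n} (\<lambda>j. {..j})"
      using abs_conv[of n, unfolded D] by (simp add: F_def W_def case_prod_unfold)
    then have "F summable_on Sigma {..n} (\<lambda>j. {..j})" by (rule abs_summable_summable)
    then obtain s where s: "(F has_sum s) (Sigma {..n} (\<lambda>j. {..j}))"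
      by (auto simp: summable_on_def)

    have "((\<lambda>j. W n j * \<beta> j) has_sum s) {..n}"
    proof (rule has_sum_SigmaD[OF s])
      fix j assume "j \<in> {..n}"
      then obtain t where t: "(bailey_term q a \<alpha> j has_sum t) {..j}"
        using abs_summable_summable[OF slice[of j n]] by (auto simp: summable_on_def)
      \<comment> \<open>The unordered sum of the slice agrees with the ordered series that defines
        beta_j.\<close>
      have "t = \<beta> j"
        using sums_of_has_sum_atMost_int[OF t] pair sums_unique2 unfolding bilateral_bailey_pair_def by blast
      with has_sum_cmult_right[OF t] show "((\<lambda>r. F (j, r)) has_sum W n j * \<beta> j) {..j}"
        by (simp add: F_def)
    qed
    from sums_of_has_sum_atMost_int[OF this] have beta: "lattice_beta q a N \<rho> \<sigma> \<beta> n = s"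
      unfolding lattice_beta_def W_def[symmetric] by (rule sums_unique[symmetric])

    \<comment> \<open>After the swap the inner sum over j runs through the finite interval from r to
      n, where \<open>kernel\<close> applies.\<close>
    have "((\<lambda>(r, j). F (j, r)) has_sum s) (Sigma {..n} (\<lambda>r. {r..n})) \<longleftrightarrow> (F has_sum s) (Sigma {..n} (\<lambda>j. {..j}))"
      by (rule has_sum_reindex_bij_witness[of _ prod.swap prod.swap]) auto
    with s have "((\<lambda>(r, j). F (j, r)) has_sum s) (Sigma {..n} (\<lambda>r. {r..n}))" by simp
    then have "((\<lambda>r. \<Sum>j=r..n. F (j, r)) has_sum s) {..n}"
      by (rule has_sum_SigmaD) (simp add: has_sum_finite)
    moreover have "(\<Sum>j=r..n. F (j, r)) = (\<Sum>i\<le>N. f n i r)" if "r \<in> {..n}" for r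
    proof -
      have "(\<Sum>j=r..n. F (j, r)) = \<alpha> r * (\<Sum>j=r..n. W n j * qkernel q a j r)"
        by (simp add: F_def bailey_term_qkernel sum_distrib_left mult_ac)
      also have "\<dots> = (\<Sum>i\<le>N. f n i r)"
        using that by (simp add: kernel f_def sum_distrib_left mult_ac)
      finally show ?thesis .
    qed
    ultimately have "((\<lambda>r. \<Sum>i\<le>N. f n i r) has_sum s) {..n}"
      by (metis (no_types, lifting) has_sum_cong)
    \<comment> \<open>All terms with r > n vanish. Over all integers the shift m = r + i becomes a
      bijection of the index set, whatever i is.\<close>
    then have total: "((\<lambda>r. \<Sum>i\<le>N. f n i r) has_sum s) UNIV"
      by (rule has_sum_cong_neutral[THEN iffD1, rotated -1]) (auto simp: f_def qkernel_0)

    define t where "t = (\<lambda>i. infsum (f n i) UNIV)"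
    have t: "(f n i has_sum t i) UNIV" if "i \<le> N" for i
      using f_summable[OF that] by (simp add: t_def)
    \<comment> \<open>Splitting the total is legitimate because each of the N + 1 series converges;
      each may then be shifted by its own i.\<close>
    have "((\<lambda>r. \<Sum>i\<le>N. f n i r) has_sum (\<Sum>i\<le>N. t i)) UNIV"
      by (rule has_sum_finite_sum) (use t in auto)
    with total have s_eq: "s = (\<Sum>i\<le>N. t i)" by (rule has_sum_unique)
    have "((\<lambda>m. f n i (m - int i)) has_sum t i) UNIV" if "i \<le> N" for i
      using t[OF that] has_sum_reindex_bij_witness[of UNIV "\<lambda>r. r + int i" "\<lambda>m. m - int i" UNIV
          "f n i" "\<lambda>m. f n i (m - int i)"] by simp
    then have "((\<lambda>m. \<Sum>i\<le>N. f n i (m - int i)) has_sum s) UNIV"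
      unfolding s_eq by (intro has_sum_finite_sum) auto
    then have "((\<lambda>m. \<Sum>i\<le>N. f n i (m - int i)) has_sum s) {..n}"
      by (rule has_sum_cong_neutral[THEN iffD1, rotated -1]) (auto simp: f_def qkernel_0)
    then show ?thesis
      unfolding bailey' beta by (rule sums_of_has_sum_atMost_int)
  qed
  then show ?thesis unfolding bilateral_bailey_pair_def b_def by blast
qed

end
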